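(* Let $n\ge 1$ and let $\phi:\mathfrak{S}_n\to\mathfrak{S}_n$ be the map defined in the context. Then for every $\pi\in\mathfrak{S}_n$, $$(\mathrm{ini},\mathrm{aix},\mathrm{des},\mathrm{aid})\,\phi(\pi)=(\mathrm{ini},\mathrm{pix},\mathrm{lec},\mathrm{inv})\,\pi,$$ that is, $\mathrm{ini}\,\phi(\pi)=\mathrm{ini}\,\pi$, $\mathrm{aix}\,\phi(\pi)=\mathrm{pix}\,\pi$, $\mathrm{des}\,\phi(\pi)=\mathrm{lec}\,\pi$ and $\mathrm{aid}\,\phi(\pi)=\mathrm{inv}\,\pi$.
   Context: $\mathfrak{S}_n$ is the set of permutations of $[n]=\{1,\dots,n\}$, written as words $\pi(1)\pi(2)\cdots\pi(n)$. All statistics below are also used for words $\pi=\pi(1)\cdots\pi(r)$ of distinct letters from a totally ordered set. Basic statistics: $\mathrm{ini}\,\pi=\pi(1)$; $\mathrm{des}\,\pi=|\{i:\pi(i)>\pi(i+1)\}|$; $\mathrm{Inv}\,\pi=\{(i,j): i<j,\ \pi(i)>\pi(j)\}$ and $\mathrm{inv}\,\pi=|\mathrm{Inv}\,\pi|$. Statistic aid: an inversion $(i,j)\in\mathrm{Inv}\,\pi$ is admissible if either $\pi(j)<\pi(j+1)$ (this alternative requires that position $j+1$ exists) or $\pi(j)>\pi(k)$ for some $k$ with $i<k<j$. Let $\mathrm{ai}\,\pi$ be the number of admissible inversions of $\pi$, and $\mathrm{aid}\,\pi=\mathrm{ai}\,\pi+\mathrm{des}\,\pi$. Statistics lec and pix: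 a word $w=w_1w_2\cdots w_r$ with $r\ge 2$ is a hook if $w_1>w_2\le w_3\le\dots\le w_r$. Every word $\pi$ factors uniquely as a concatenation $\pi=\pi_0\pi_1\cdots\pi_k$ ($k\ge 0$) with $\pi_0$ a (possibly empty) nondecreasing word and each $\pi_i$, $1\le i\le k$, a hook. Then $\mathrm{lec}\,\pi=\sum_{i=1}^k\mathrm{inv}\,\pi_i$ and $\mathrm{pix}\,\pi=|\pi_0|$, the length of $\pi_0$. Statistic aix: defined recursively by $\mathrm{aix}\,\emptyset=0$ and, for $\pi\ne\emptyset$ with smallest letter $m$, writing $\pi=\alpha m\beta$ where $\alpha$ does not contain $m$: $\mathrm{aix}\,\pi=1+\mathrm{aix}\,\beta$ if $\alpha=\emptyset$; $\mathrm{aix}\,\pi=0$ if $\alpha\neq\emptyset$ and $\beta=\emptyset$; $\mathrm{aix}\,\pi=\mathrm{aix}\,\alpha$ if $\alpha\ne\emptyset$ and $\beta\ne\emptyset$. The map $f$: let $S$ be a finite set of letters, $k\notin S$, with $S\cup\{k\}$ totally ordered, $\tau$ a permutation (arrangement as a word) of $S$, and $m$ the smallest letter of $S\cup\{k\}$. Define the arrangement $f(k,\tau)$ of $S\cup\{k\}$ recursively by $f(k,\emptyset)=k$ and - $f(k,\tau)=f(k,\alpha)\,m\beta$ if $k>m$ and $\tau=\alpha m\beta$ with $\alpha\ne\emptyset$, $\beta\ne\emptyset$; - $f(k,\tau)=f(k,\beta)\,m$ if $k>m$ and $\tau=m\beta$; - $f(k,\tau)=km\alpha$ if $k>m$ and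 $\tau=\alpha m$; - $f(k,\tau)=k\tau$ if $k=m$. (If $\tau=m$, the second and third rules both give $km$.) The map $\phi$: for $\pi\in\mathfrak{S}_n$ put $\phi_0(\pi)=\emptyset$, $\phi_k(\pi)=f(\pi(n-k+1),\phi_{k-1}(\pi))$ for $k=1,\dots,n$, and $\phi(\pi)=\phi_n(\pi)$. *)

theory Defs
  imports "HOL-Combinatorics.Multiset_Permutations"
begin

text \<open>
  Words are lists over a linearly ordered type, and \<open>\<SS>\<^sub>n\<close> is
  \<^term>\<open>permutations_of_set {1..n::nat}\<close>.  Positions in words are counted from \<open>0\<close>, as usual
  for lists, so the word letter \<open>\<pi>(i)\<close> is \<open>\<pi> ! (i - 1)\<close>.
\<close>

definition ini :: "'a list \<Rightarrow> 'a" where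
  "ini w = hd w"

definition des :: "'a::linorder list \<Rightarrow> nat" where
  "des w = card {i. Suc i < length w \<and> w ! i > w ! Suc i}"

definition Inversions :: "'a::linorder list \<Rightarrow> (nat \<times> nat) set" where
  "Inversions w = {(i, j). i < j \<and> j < length w \<and> w ! i > w ! j}"

definition inversion_number :: "'a::linorder list \<Rightarrow> nat" where
  "inversion_number w = card (Inversions w)"


definition admissible :: "'a::linorder list \<Rightarrow> nat \<times> nat \<Rightarrow> bool" where
  "admissible w = (\<lambda>(i, j).
     (Suc j < length w \<and> w ! j < w ! Suc j) \<or> (\<exists>k. i < k \<and> k < j \<and> w ! j > w ! k))"

definition ai :: "'a::linorder list \<Rightarrow> nat" where
  "ai w = card {p \<in> Inversions w. admissible w p}"

definition aid :: "'a::linorder list \<Rightarrow> nat" where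
  "aid w = ai w + des w"


definition hook :: "'a::linorder list \<Rightarrow> bool" where
  "hook w \<longleftrightarrow> length w \<ge> 2 \<and> w ! 0 > w ! 1 \<and> sorted (tl w)"

definition is_hook_factorization :: "'a::linorder list \<Rightarrow> 'a list \<times> 'a list list \<Rightarrow> bool" where
  "is_hook_factorization w = (\<lambda>(w0, hs).
     w = w0 @ concat hs \<and> sorted w0 \<and> (\<forall>h \<in> set hs. hook h))"

lemma hook_Cons: "hook (x # w) \<longleftrightarrow> w \<noteq> [] \<and> x > hd w \<and> sorted w"
  by (cases w) (auto simp: hook_def)

theorem ex1_hook_factorization: "\<exists>!p. is_hook_factorization w p"
proof (induction w)
  case Nil
  show ?case
  proof (rule ex1I[of _ "([], [])"])
    fix p :: "'a list \<times> 'a list list"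
    assume p: "is_hook_factorization [] p"
    obtain w0 hs where [simp]: "p = (w0, hs)" by (cases p)
    have "\<not> hook ([] :: 'a list)" by (simp add: hook_def)
    with p show "p = ([], [])"
      by (cases hs) (auto simp: is_hook_factorization_def)
  qed (simp add: is_hook_factorization_def)
next
  case (Cons x w)
  then obtain w0 hs where ex: "is_hook_factorization w (w0, hs)"
    and uniq: "\<And>v gs. is_hook_factorization w (v, gs) \<Longrightarrow> v = w0 \<and> gs = hs"
    by (metis prod.exhaust prod.inject)
  define q where "q = (if w0 = [] \<or> x \<le> hd w0 then (x # w0, hs) else ([], (x # w0) # hs))"
  show ?case
  proof (rule ex1I[of _ q])
    show "is_hook_factorization (x # w) q"
      using ex by (cases w0) (auto simp: q_def is_hook_factorization_def hook_Cons)
  next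
    fix p assume p: "is_hook_factorization (x # w) p"
    obtain v gs where [simp]: "p = (v, gs)" by (cases p)
    show "p = q"
    proof (cases v)
      case Nil
      with p obtain g gs' where gs: "gs = g # gs'"
        by (cases gs) (auto simp: is_hook_factorization_def)
      with p Nil have "hook g" by (auto simp: is_hook_factorization_def)
      then obtain t where g: "g = x # t"
        using p gs Nil by (cases g) (auto simp: is_hook_factorization_def hook_def)
      have "is_hook_factorization w (t, gs')"
        using p gs Nil g by (auto simp: is_hook_factorization_def hook_Cons)
      from uniq[OF this] \<open>hook g\<close> show ?thesis
        by (auto simp: Nil gs g q_def hook_Cons)
    next
      case (Cons y t)
      with p have "is_hook_factorization w (t, gs)" and [simp]: "y = x"
        by (auto simp: is_hook_factorization_def)
      from uniq[OF this(1)] p show ?thesis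
        by (cases t) (auto simp: Cons q_def is_hook_factorization_def)
    qed
  qed
qed

definition hook_factorization :: "'a::linorder list \<Rightarrow> 'a list \<times> 'a list list" where
  "hook_factorization w = (THE p. is_hook_factorization w p)"

lemma hook_factorization: "is_hook_factorization w (hook_factorization w)"
  unfolding hook_factorization_def by (rule theI') (rule ex1_hook_factorization)

definition lec :: "'a::linorder list \<Rightarrow> nat" where
  "lec w = sum_list (map inversion_number (snd (hook_factorization w)))"

definition pix :: "'a::linorder list \<Rightarrow> nat" where
  "pix w = length (fst (hook_factorization w))"


text \<open>If \<open>m\<close> occurs in \<open>w\<close>, then \<open>w = before m w @ m # after m w\<close>, splitting at the first \<open>m\<close>.\<close>

definition before :: "'a \<Rightarrow> 'a list \<Rightarrow> 'a list" where
  "before m w = takeWhile (\<lambda>x. x \<noteq> m) w"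

definition after :: "'a \<Rightarrow> 'a list \<Rightarrow> 'a list" where
  "after m w = tl (dropWhile (\<lambda>x. x \<noteq> m) w)"

lemma before_after: "m \<in> set w \<Longrightarrow> w = before m w @ m # after m w"
  by (induction w) (auto simp: before_def after_def)

lemma notin_before: "m \<notin> set (before m w)"
  by (auto simp: before_def dest: set_takeWhileD)

lemma length_before_less: "m \<in> set w \<Longrightarrow> length (before m w) < length w"
  using arg_cong[OF before_after, of m w length] by simp

lemma length_after_less: "w \<noteq> [] \<Longrightarrow> length (after m w) < length w"
  using length_dropWhile_le[of "\<lambda>x. x \<noteq> m" w]
  by (cases w) (auto simp: after_def)

function aix :: "'a::linorder list \<Rightarrow> nat" where
  "aix w =
     (if w = [] then 0
      else if before (Min (set w)) w = [] then 1 + aix (after (Min (set w)) w)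
      else if after (Min (set w)) w = [] then 0
      else aix (before (Min (set w)) w))"
  by auto
termination
  by (relation "measure length") (auto intro!: length_before_less length_after_less)

declare aix.simps [simp del]

text \<open>
  The map \<open>f\<close>.  It is only meaningful for distinct \<open>w\<close> and \<open>k \<notin> set w\<close>; then \<open>m\<close> occurs in \<open>w\<close>
  whenever \<open>k \<noteq> m\<close>.  If \<open>w = [m]\<close>, the second and third rules agree, and the second is applied.
\<close>

function f_map :: "'a::linorder \<Rightarrow> 'a list \<Rightarrow> 'a list" where
  "f_map k w =
     (let m = Min (insert k (set w)) in
      if w = [] then [k]
      else if k = m then k # w
      else if before m w \<noteq> [] \<and> after m w \<noteq> [] then f_map k (before m w) @ m # after m w
      else if before m w = [] then f_map k (after m w) @ [m]
      else k # m # before m w)"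
  by auto
termination
proof (relation "measure (\<lambda>(k, w). length w)", goal_cases)
  case (2 k w m)
  have "m \<in> insert k (set w)"
    unfolding 2(1) by (rule Min_in) auto
  with 2 show ?case by (auto intro: length_before_less)
qed (auto intro: length_after_less)

declare f_map.simps [simp del]

text \<open>\<open>phi_step j \<pi>\<close> is \<open>\<phi>\<^sub>j(\<pi>)\<close>, where \<open>n = length \<pi>\<close>.\<close>

primrec phi_step :: "nat \<Rightarrow> 'a::linorder list \<Rightarrow> 'a list" where
  "phi_step 0 \<pi> = []"
| "phi_step (Suc j) \<pi> = f_map (\<pi> ! (length \<pi> - Suc j)) (phi_step j \<pi>)"

definition phi :: "'a::linorder list \<Rightarrow> 'a list" where
  "phi \<pi> = phi_step (length \<pi>) \<pi>"

end

theory Submission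
  imports Defs
begin

text \<open>
  The number \<open>aix w\<close> is the length of a subword of \<open>w\<close> obtained by the same recursion.  When a
  letter \<open>k\<close> is put in front of a word with hook factorization \<open>(w\<^sub>0, hs)\<close>, either \<open>w\<^sub>0\<close> grows to
  \<open>k w\<^sub>0\<close> or \<open>k w\<^sub>0\<close> becomes a new hook, and \<open>f(k, \<cdot>)\<close> changes the \<open>aix\<close> subword in exactly the same
  way.  Hence the \<open>aix\<close> subword of \<open>\<phi>(w)\<close> is \<open>w\<^sub>0\<close> itself, which makes \<open>lec\<close> and \<open>inv\<close> of \<open>k w\<close>
  computable from \<open>\<phi>(w)\<close>: they increase by the number of letters smaller than \<open>k\<close> in the \<open>aix\<close>
  subword and in the whole word, respectively.  By splitting words at their smallest letter one
  checks that \<open>des\<close> and \<open>aid\<close> of \<open>f(k, \<cdot>)\<close> increase by the same amounts.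
\<close>

section \<open>Splitting a word at its smallest letter\<close>

lemma Min_split:
  assumes "\<forall>x\<in>set \<alpha> \<union> set \<beta>. m < (x::'a::linorder)"
  shows "Min (set (\<alpha> @ m # \<beta>)) = m" "before m (\<alpha> @ m # \<beta>) = \<alpha>" "after m (\<alpha> @ m # \<beta>) = \<beta>"
proof -
  show "Min (set (\<alpha> @ m # \<beta>)) = m"
    using assms by (intro Min_eqI) (auto simp: less_imp_le)
  have "\<forall>x\<in>set \<alpha>. x \<noteq> m" using assms by auto
  then show "before m (\<alpha> @ m # \<beta>) = \<alpha>" "after m (\<alpha> @ m # \<beta>) = \<beta>"
    by (simp_all add: before_def after_def takeWhile_append dropWhile_append)
qed

text \<open>The two sides of the smallest letter are shorter words, so induction on the length
  suffices. This is the splitting along which \<open>aix\<close> and f recurse.\<close>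

lemma min_split_induct [consumes 1, case_names Nil split]:
  fixes w :: "'a::linorder list"
  assumes "distinct w"
    and Nil: "P []"
    and split: "\<And>\<alpha> m \<beta>. distinct (\<alpha> @ m # \<beta>) \<Longrightarrow> \<forall>x\<in>set \<alpha> \<union> set \<beta>. m < x \<Longrightarrow> P \<alpha> \<Longrightarrow> P \<beta> \<Longrightarrow> P (\<alpha> @ m # \<beta>)"
  shows "P w"
  using assms(1)
proof (induction w rule: length_induct)
  case (1 w)
  show ?case
  proof (cases "w = []")
    case False
    define m where "m = Min (set w)"
    have "m \<in> set w" using False by (simp add: m_def)
    then obtain \<alpha> \<beta> where w: "w = \<alpha> @ m # \<beta>" by (meson split_list)
    have "\<forall>x\<in>set w. m \<le> x" by (simp add: m_def)
    with 1(2) have "\<forall>x\<in>set \<alpha> \<union> set \<beta>. m < x" unfolding w by (auto simp: order_less_le)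
    moreover have "P \<alpha>" "P \<beta>" using 1 w by auto
    ultimately show ?thesis using 1(2) split unfolding w by blast
  qed (simp add: Nil)
qed

section \<open>Descents and admissible inversions\<close>

lemma des_Nil [simp]: "des [] = 0"
  by (simp add: des_def)

lemma des_Cons: "des (x # w) = of_bool (w \<noteq> [] \<and> hd w < x) + des w"
proof -
  have "{i. Suc i < length (x # w) \<and> (x # w) ! i > (x # w) ! Suc i} =
    (if w \<noteq> [] \<and> hd w < x then {0} else {}) \<union> Suc ` {i. Suc i < length w \<and> w ! i > w ! Suc i}"
    (is "?A = ?B")
  proof (rule set_eqI)
    show "i \<in> ?A \<longleftrightarrow> i \<in> ?B" for i by (cases i) (auto simp: hd_conv_nth)
  qed
  moreover have "finite {i. Suc i < length w \<and> w ! i > w ! Suc i}"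
    by (rule finite_subset[of _ "{..<length w}"]) auto
  ultimately show ?thesis
    unfolding des_def by (simp add: card_image)
qed

text \<open>Since m is smallest, the border before m is a descent and the border after it is
  not.\<close>

lemma des_min_split:
  assumes "\<forall>x\<in>set \<alpha> \<union> set \<beta>. m < x"
  shows "des (\<alpha> @ m # \<beta>) = des \<alpha> + des \<beta> + of_bool (\<alpha> \<noteq> [])"
  using assms
proof (induction \<alpha>)
  case Nil
  then show ?case by (cases \<beta>) (auto simp: des_Cons)
next
  case (Cons x \<alpha>)
  then show ?case by (cases \<alpha>) (auto simp: des_Cons)
qed

abbreviation count_less :: "'a::linorder \<Rightarrow> 'a list \<Rightarrow> nat" where
  "count_less x w \<equiv> length (filter (\<lambda>y. y < x) w)"

text \<open>Admissible inversions of \<open>x # w\<close> whose left letter is \<open>x\<close>.\<close>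

definition ai_front :: "'a::linorder \<Rightarrow> 'a list \<Rightarrow> nat" where
  "ai_front x w = card {j. j < length w \<and> w ! j < x \<and>
     ((Suc j < length w \<and> w ! j < w ! Suc j) \<or> (\<exists>k<j. w ! k < w ! j))}"

lemma finite_Inversions: "finite (Inversions w)"
  by (rule finite_subset[of _ "{..<length w} \<times> {..<length w}"]) (auto simp: Inversions_def)

lemma admissible_Cons_0:
  "admissible (x # w) (0, Suc j) \<longleftrightarrow>
    (Suc j < length w \<and> w ! j < w ! Suc j) \<or> (\<exists>k<j. w ! k < w ! j)"
  by (auto simp: admissible_def gr0_conv_Suc)

text \<open>Admissibility only involves letters to the right of the left letter of the pair, up to
  one place past its right letter.\<close>

lemma admissible_Cons_Suc: "admissible (x # w) (Suc i, Suc j) \<longleftrightarrow> admissible w (i, j)"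
  by (auto simp: admissible_def Suc_less_eq2)

lemma Inversions_Cons:
  "Inversions (x # w) =
    (\<lambda>j. (0, Suc j)) ` {j. j < length w \<and> w ! j < x} \<union> map_prod Suc Suc ` Inversions w"
  (is "?A = ?B")
proof (rule set_eqI)
  fix p :: "nat \<times> nat"
  obtain i j where "p = (i, j)" by fastforce
  then show "p \<in> ?A \<longleftrightarrow> p \<in> ?B"
    by (cases i; cases j) (auto simp: Inversions_def)
qed

text \<open>The predicate is left free so that one count serves both \<open>inversion_number\<close>
  and \<open>ai\<close>.\<close>

lemma card_Inversions_Cons:
  "card {p \<in> Inversions (x # w). P p} =
    card {j. j < length w \<and> w ! j < x \<and> P (0, Suc j)} +
    card {(i, j) \<in> Inversions w. P (Suc i, Suc j)}"
proof -
  have "{p \<in> Inversions (x # w). P p} =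
    (\<lambda>j. (0, Suc j)) ` {j. j < length w \<and> w ! j < x \<and> P (0, Suc j)} \<union>
    map_prod Suc Suc ` {(i, j) \<in> Inversions w. P (Suc i, Suc j)}"
    unfolding Inversions_Cons by auto
  moreover have "finite {(i, j) \<in> Inversions w. P (Suc i, Suc j)}"
    by (rule finite_subset[OF _ finite_Inversions[of w]]) auto
  moreover have "inj_on (\<lambda>j. (0::nat, Suc j)) A" "inj_on (map_prod Suc Suc) B" for A B
    by (auto intro!: inj_onI)
  moreover have "((\<lambda>j. (0, Suc j)) ` A) \<inter> (map_prod Suc Suc ` B) = {}" for A B
    by auto
  ultimately show ?thesis
    by (simp add: card_image card_Un_disjoint)
qed

lemma inversion_number_Nil [simp]: "inversion_number [] = 0"
  by (simp add: inversion_number_def Inversions_def)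

lemma inversion_number_Cons:
  "inversion_number (x # w) = count_less x w + inversion_number w"
  using card_Inversions_Cons[of x w "\<lambda>_. True"]
  by (simp add: inversion_number_def length_filter_conv_card)

lemma inversion_number_sorted: "sorted w \<Longrightarrow> inversion_number w = 0"
  by (induction w) (auto simp: inversion_number_Cons filter_empty_conv)

lemma ai_Nil [simp]: "ai [] = 0"
  by (simp add: ai_def Inversions_def)

lemma ai_Cons: "ai (x # w) = ai_front x w + ai w"
proof -
  have "{(i, j). (i, j) \<in> Inversions w \<and> admissible w (i, j)} = {p \<in> Inversions w. admissible w p}"
    by auto
  then show ?thesis
    unfolding ai_def ai_front_def card_Inversions_Cons
    by (simp add: admissible_Cons_0 admissible_Cons_Suc)
qed

lemma ai_front_le: "\<forall>y\<in>set w. x \<le> y \<Longrightarrow> ai_front x w = 0"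
  by (auto simp: ai_front_def all_set_conv_all_nth not_less)

text \<open>
  To the right of \<open>m\<close> every inversion is admissible because of \<open>m\<close>, and inversions ending at \<open>m\<close>
  are admissible iff \<open>m\<close> is not the last letter.
\<close>

lemma ai_front_min_split:
  assumes "\<forall>y\<in>set \<alpha> \<union> set \<beta>. m < y" and "m < x"
  shows "ai_front x (\<alpha> @ m # \<beta>) = ai_front x \<alpha> + of_bool (\<beta> \<noteq> []) + count_less x \<beta>"
proof -
  let ?w = "\<alpha> @ m # \<beta>" and ?n = "length \<alpha>"
  let ?adm = "\<lambda>w j. (Suc j < length w \<and> w ! j < w ! Suc j) \<or> (\<exists>k<j. w ! k < w ! j)"
  have \<alpha>: "m < \<alpha> ! j" if "j < ?n" for j using assms(1) that by simp
  have \<beta>: "m < \<beta> ! j" if "j < length \<beta>" for j using assms(1) that by simp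
  have left: "?adm ?w j \<longleftrightarrow> ?adm \<alpha> j" if "j < ?n" for j
  proof -
    have "(\<exists>k<j. ?w ! k < ?w ! j) \<longleftrightarrow> (\<exists>k<j. \<alpha> ! k < \<alpha> ! j)"
      using that by (intro ex_cong1 conj_cong refl) (simp add: nth_append)
    moreover have "Suc j < length ?w \<and> ?w ! j < ?w ! Suc j \<longleftrightarrow> Suc j < ?n \<and> \<alpha> ! j < \<alpha> ! Suc j"
    proof (cases "Suc j < ?n")
      \<comment> \<open>The last letter of \<alpha> is now followed by the smaller m, so it gains no
        ascent.\<close>
      case False
      with that have "Suc j = ?n" by simp
      with \<alpha>[OF that] show ?thesis by (simp add: nth_append)
    qed (simp add: nth_append)
    ultimately show ?thesis by (rule arg_cong2[of _ _ _ _ "\<lambda>p q. q \<or> p"])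
  qed
  have mid: "?adm ?w ?n \<longleftrightarrow> \<beta> \<noteq> []"
  proof -
    have "\<not> (\<exists>k<?n. ?w ! k < ?w ! ?n)"
      using \<alpha> by (auto simp: nth_append dest: order.asym)
    moreover have "Suc ?n < length ?w \<and> ?w ! ?n < ?w ! Suc ?n \<longleftrightarrow> \<beta> \<noteq> []"
      using \<beta>[of 0] by (auto simp: nth_append)
    ultimately show ?thesis by blast
  qed
  have right: "?adm ?w (?n + Suc j)" if "j < length \<beta>" for j
    using \<beta>[OF that] by (intro disjI2 exI[of _ ?n]) (simp add: nth_append)
  let ?L = "{j. j < ?n \<and> \<alpha> ! j < x \<and> ?adm \<alpha> j}"
  let ?M = "if \<beta> \<noteq> [] then {?n} else {}"
  let ?R = "(\<lambda>j. ?n + Suc j) ` {j. j < length \<beta> \<and> \<beta> ! j < x}"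
  have "{j. j < length ?w \<and> ?w ! j < x \<and> ?adm ?w j} = ?L \<union> ?M \<union> ?R" (is "?A = _")
  proof (rule set_eqI)
    fix j
    consider "j < ?n" | "j = ?n" | i where "j = ?n + Suc i"
      by (metis less_imp_Suc_add linorder_neqE_nat add_Suc_right)
    then show "j \<in> ?A \<longleftrightarrow> j \<in> ?L \<union> ?M \<union> ?R"
    proof cases
      case 1
      with left[OF 1] show ?thesis by (auto simp: nth_append)
    next
      case 2
      with mid \<open>m < x\<close> show ?thesis by auto
    next
      case (3 i)
      have "j < length ?w \<longleftrightarrow> i < length \<beta>" and "?w ! j = \<beta> ! i"
        unfolding 3 by (simp_all add: nth_append)
      with right[of i, folded 3] have "j \<in> ?A \<longleftrightarrow> i < length \<beta> \<and> \<beta> ! i < x"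
        unfolding mem_Collect_eq by metis
      moreover have "j \<in> ?R \<longleftrightarrow> i < length \<beta> \<and> \<beta> ! i < x" and "j \<notin> ?L \<union> ?M"
        unfolding 3 by auto
      ultimately show ?thesis by blast
    qed
  qed
  moreover have "card (?L \<union> ?M \<union> ?R) = card ?L + card ?M + card ?R"
    by (subst card_Un_disjoint; (subst card_Un_disjoint)?; force)
  moreover have "card ?R = count_less x \<beta>"
    by (subst card_image) (auto simp: length_filter_conv_card inj_on_def)
  ultimately show ?thesis
    by (simp add: ai_front_def)
qed

text \<open>Peeling off the letters of \<alpha>, each one meets m (counted iff \<beta> is nonempty)
  and its smaller letters in \<beta>. The letter m itself starts no inversion.\<close>

lemma ai_min_split:
  assumes "\<forall>x\<in>set \<alpha> \<union> set \<beta>. m < x"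
  shows "ai (\<alpha> @ m # \<beta>) = ai \<alpha> + ai \<beta> + of_bool (\<beta> \<noteq> []) * length \<alpha> +
    (\<Sum>x\<leftarrow>\<alpha>. count_less x \<beta>)"
  using assms
proof (induction \<alpha>)
  case Nil
  then show ?case by (simp add: ai_Cons ai_front_le less_imp_le)
next
  case (Cons x \<alpha>)
  then show ?case by (simp add: ai_Cons ai_front_min_split)
qed

lemmas des_left = des_min_split[of "[]", simplified]
lemmas des_right = des_min_split[of _ "[]", simplified]
lemmas ai_left = ai_min_split[of "[]", simplified]
lemmas ai_right = ai_min_split[of _ "[]", simplified]

section \<open>The map f\<close>

lemma f_map_Nil [simp]: "f_map k [] = [k]"
  by (simp add: f_map.simps)

lemma f_map_less:
  assumes "\<forall>x\<in>set w. k < x"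
  shows "f_map k w = k # w"
proof -
  have "Min (insert k (set w)) = k"
    using assms by (intro Min_eqI) (auto simp: less_imp_le)
  then show ?thesis by (simp add: f_map.simps)
qed

lemma f_map_min_split:
  assumes "\<forall>x\<in>set \<alpha> \<union> set \<beta>. m < x" and "m < k"
  shows "f_map k (\<alpha> @ m # \<beta>) =
    (if \<alpha> = [] then f_map k \<beta> @ [m]
     else if \<beta> = [] then k # m # \<alpha>
     else f_map k \<alpha> @ m # \<beta>)"
proof -
  have "Min (insert k (set (\<alpha> @ m # \<beta>))) = m"
    using Min_split(1)[OF assms(1)] assms(2) by (subst Min_insert) auto
  moreover have "k \<noteq> m" using assms(2) by simp
  ultimately show ?thesis
    by (subst f_map.simps) (simp only: Let_def Min_split(2,3)[OF assms(1)], simp)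
qed

text \<open>The cases are the branches of f for a fixed k; \<open>right\<close> has no induction
  hypothesis because that branch does not recurse.\<close>

lemma f_map_induct [consumes 2, case_names below left right mid]:
  fixes w :: "'a::linorder list"
  assumes "distinct w" "k \<notin> set w"
    and below: "\<And>w. distinct w \<Longrightarrow> \<forall>x\<in>set w. k < x \<Longrightarrow> P w"
    and left: "\<And>m \<beta>. distinct \<beta> \<Longrightarrow> k \<notin> set \<beta> \<Longrightarrow> \<forall>x\<in>set \<beta>. m < x \<Longrightarrow> m < k \<Longrightarrow> P \<beta> \<Longrightarrow> P (m # \<beta>)"
    and right: "\<And>\<alpha> m. \<forall>x\<in>set \<alpha>. m < x \<Longrightarrow> m < k \<Longrightarrow> \<alpha> \<noteq> [] \<Longrightarrow> P (\<alpha> @ [m])"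
    and mid: "\<And>\<alpha> m \<beta>. distinct \<alpha> \<Longrightarrow> k \<notin> set \<alpha> \<Longrightarrow> \<forall>x\<in>set \<alpha> \<union> set \<beta>. m < x \<Longrightarrow> m < k \<Longrightarrow> \<alpha> \<noteq> [] \<Longrightarrow> \<beta> \<noteq> [] \<Longrightarrow>
      P \<alpha> \<Longrightarrow> P (\<alpha> @ m # \<beta>)"
  shows "P w"
  using assms(1,2)
proof (induction w rule: min_split_induct)
  case Nil
  show ?case by (rule below) simp_all
next
  case (split \<alpha> m \<beta>)
  show ?case
  proof (cases "k < m")
    case True
    with split show ?thesis by (intro below) (auto intro: less_trans)
  next
    case False
    with split have "m < k" by auto
    with split left[of \<beta> m] right[of \<alpha> m] mid[of \<alpha> \<beta> m] show ?thesis
      by (cases "\<alpha> = []"; cases "\<beta> = []") auto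
  qed
qed

lemmas f_map_left = f_map_min_split[of "[]", simplified]
lemmas f_map_right = f_map_min_split[of _ "[]", simplified]

text \<open>Multisets, rather than sets, also transport sums over the letters of a word.\<close>

lemma mset_f_map:
  assumes "distinct w" "k \<notin> set w"
  shows "mset (f_map k w) = add_mset k (mset w)"
  using assms
  by (induction w rule: f_map_induct)
    (simp_all add: f_map_less f_map_left f_map_right f_map_min_split)

lemma f_map_simps_mset:
  assumes "distinct w" "k \<notin> set w"
  shows "set (f_map k w) = insert k (set w)" and "length (f_map k w) = Suc (length w)"
  using arg_cong[OF mset_f_map[OF assms], of set_mset] arg_cong[OF mset_f_map[OF assms], of size]
  by simp_all

lemma f_map_neq_Nil [simp]: "f_map k w \<noteq> []"
  by (subst f_map.simps) (auto simp: Let_def)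

lemma hd_f_map:
  assumes "distinct w" "k \<notin> set w"
  shows "hd (f_map k w) = k"
  using assms
  by (induction w rule: f_map_induct)
    (simp_all add: f_map_less f_map_left f_map_right f_map_min_split)

text \<open>When m moves to the end, it gains the descent into it. In \<open>right\<close>, k gets
  admissible inversions with m and with all smaller letters of \<alpha>, while the descent into m
  persists. In \<open>mid\<close>, k gains those with m and with smaller letters of \<beta>; the
  rest is induction.\<close>

lemma aid_f_map:
  assumes "distinct w" "k \<notin> set w"
  shows "aid (f_map k w) = aid w + count_less k w"
  using assms
proof (induction w rule: f_map_induct)
  case (below w)
  then show ?case
    by (simp add: f_map_less aid_def des_left ai_left filter_empty_conv not_less less_imp_le)
next
  case (left m \<beta>)
  \<comment> \<open>The image only adds k > m, so m stays smallest and the splitting lemmas apply to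
    it as well.\<close>
  then have "\<forall>x\<in>set (f_map k \<beta>). m < x" by (simp add: f_map_simps_mset)
  with left show ?case
    by (simp add: f_map_left aid_def des_left des_right ai_left ai_right)
next
  case (right \<alpha> m)
  then show ?case
    by (simp add: f_map_right aid_def des_Cons[of k] des_left des_right ai_right ai_Cons[of k "[]"]
        ai_front_def ai_min_split[of "[k]", simplified])
next
  case (mid \<alpha> m \<beta>)
  then have "\<forall>x\<in>set (f_map k \<alpha>) \<union> set \<beta>. m < x" by (auto simp: f_map_simps_mset)
  moreover have "(\<Sum>x\<leftarrow>f_map k \<alpha>. count_less x \<beta>) = count_less k \<beta> + (\<Sum>x\<leftarrow>\<alpha>. count_less x \<beta>)"
    using mset_f_map[OF mid(1,2)] by (simp flip: sum_mset_sum_list)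
  ultimately show ?case
    using mid by (simp add: f_map_min_split aid_def des_min_split ai_min_split f_map_simps_mset)
qed

section \<open>The subword counted by \<open>aix\<close>\<close>

function aix_word :: "'a::linorder list \<Rightarrow> 'a list" where
  "aix_word w =
     (if w = [] then []
      else if before (Min (set w)) w = [] then Min (set w) # aix_word (after (Min (set w)) w)
      else if after (Min (set w)) w = [] then []
      else aix_word (before (Min (set w)) w))"
  by auto
termination
  by (relation "measure length") (auto intro!: length_before_less length_after_less)

declare aix_word.simps [simp del]

text \<open>The letters are recorded, and not just counted, because the effect of f on
  \<open>aix\<close> and \<open>des\<close> depends on how k compares with them.\<close>

lemma length_aix_word: "length (aix_word w) = aix w"
  by (induction w rule: aix.induct) (subst aix.simps, subst aix_word.simps, simp)

lemma aix_word_Nil [simp]: "aix_word [] = []"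
  by (simp add: aix_word.simps)

lemma aix_word_min_split:
  assumes "\<forall>x\<in>set \<alpha> \<union> set \<beta>. m < x"
  shows "aix_word (\<alpha> @ m # \<beta>) =
    (if \<alpha> = [] then m # aix_word \<beta> else if \<beta> = [] then [] else aix_word \<alpha>)"
  by (subst aix_word.simps) (simp only: Min_split[OF assms], simp)

lemmas aix_word_left = aix_word_min_split[of "[]", simplified]
lemmas aix_word_right = aix_word_min_split[of _ "[]", simplified]

lemma set_aix_word:
  assumes "distinct w"
  shows "set (aix_word w) \<subseteq> set w"
  using assms by (induction w rule: min_split_induct) (auto simp: aix_word_min_split)

text \<open>In \<open>left\<close>, m < k heads the subword, and the image ends in m after a
  nonempty prefix, which gives \<open>[]\<close>. In \<open>right\<close>, the subword is empty and
  that of \<open>k # m # \<alpha>\<close> is that of \<open>[k]\<close>. In \<open>mid\<close>, both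
  sides recurse into the part before m.\<close>

lemma aix_word_f_map:
  assumes "distinct w" "k \<notin> set w"
  shows "aix_word (f_map k w) =
    (if aix_word w = [] \<or> k \<le> hd (aix_word w) then k # aix_word w else [])"
  using assms
proof (induction w rule: f_map_induct)
  case (below w)
  moreover from below have "aix_word w = [] \<or> k \<le> hd (aix_word w)"
    using set_aix_word[of w] by (cases "aix_word w") (auto simp: less_imp_le)
  ultimately show ?case by (simp add: f_map_less aix_word_left)
next
  case (left m \<beta>)
  then have "\<forall>x\<in>set (f_map k \<beta>). m < x" by (simp add: f_map_simps_mset)
  with left show ?case
    by (simp add: f_map_left aix_word_left aix_word_right)
next
  case (right \<alpha> m)
  then show ?case
    by (simp add: f_map_right aix_word_right aix_word_min_split[of "[k]", simplified]
       aix_word_left[of "[]", simplified])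
next
  case (mid \<alpha> m \<beta>)
  then have "\<forall>x\<in>set (f_map k \<alpha>) \<union> set \<beta>. m < x" by (auto simp: f_map_simps_mset)
  with mid show ?case by (simp add: f_map_min_split aix_word_min_split)
qed

text \<open>In \<open>left\<close>, the new descent into the final m matches m itself in the
  subword. In \<open>right\<close>, one descent into m is traded for another and the subword is
  empty.\<close>

lemma des_f_map:
  assumes "distinct w" "k \<notin> set w"
  shows "des (f_map k w) = des w + count_less k (aix_word w)"
  using assms
proof (induction w rule: f_map_induct)
  case (below w)
  moreover from below have "count_less k (aix_word w) = 0"
    using set_aix_word[of w] by (force simp: filter_empty_conv)
  ultimately show ?case by (simp add: f_map_less des_left)
next
  case (left m \<beta>)
  then have "\<forall>x\<in>set (f_map k \<beta>). m < x" by (simp add: f_map_simps_mset)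
  with left show ?case
    by (simp add: f_map_left aix_word_left des_left des_right)
next
  case (right \<alpha> m)
  then show ?case
    by (simp add: f_map_right aix_word_right des_right des_Cons[of k] des_left)
next
  case (mid \<alpha> m \<beta>)
  then have "\<forall>x\<in>set (f_map k \<alpha>) \<union> set \<beta>. m < x" by (auto simp: f_map_simps_mset)
  with mid show ?case by (simp add: f_map_min_split aix_word_min_split des_min_split)
qed

section \<open>The map phi\<close>

text \<open>Step j reads only the last j letters; hence \<open>phi\<close> is a right fold of
  f.\<close>

lemma phi_step_Cons: "j \<le> length w \<Longrightarrow> phi_step j (x # w) = phi_step j w"
  by (induction j) (simp_all add: Suc_diff_le)

lemma phi_Nil [simp]: "phi [] = []"
  by (simp add: phi_def)

lemma phi_Cons [simp]: "phi (x # w) = f_map x (phi w)"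
  by (simp add: phi_def phi_step_Cons)

lemma mset_phi: "distinct w \<Longrightarrow> mset (phi w) = mset w"
proof (induction w)
  case (Cons x w)
  then have mset: "mset (phi w) = mset w" by simp
  with Cons.prems have "distinct (phi w)" "x \<notin> set (phi w)"
    using mset_eq_imp_distinct_iff[OF mset] mset_eq_setD[OF mset] by simp_all
  with mset show ?case by (simp add: mset_f_map)
qed simp

lemma distinct_phi: "distinct w \<Longrightarrow> distinct (phi w)"
  using mset_eq_imp_distinct_iff[OF mset_phi] by blast

lemma set_phi: "distinct w \<Longrightarrow> set (phi w) = set w"
  by (rule mset_eq_setD[OF mset_phi])

section \<open>Hook factorizations and comparison with phi\<close>

lemma hook_factorization_eqI: "is_hook_factorization w p \<Longrightarrow> hook_factorization w = p"
  using ex1_hook_factorization hook_factorization by blast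

lemma hook_factorization_Nil: "hook_factorization [] = ([], [])"
  by (rule hook_factorization_eqI) (simp add: is_hook_factorization_def)

lemma hook_factorization_Cons:
  assumes "hook_factorization w = (w0, hs)"
  shows "hook_factorization (x # w) =
    (if w0 = [] \<or> x \<le> hd w0 then (x # w0, hs) else ([], (x # w0) # hs))"
  using hook_factorization[of w] assms
  by (intro hook_factorization_eqI, cases w0) (auto simp: is_hook_factorization_def hook_Cons)

text \<open>As w0 is sorted, either no letter of it is below x, or \<open>x # w0\<close> is a new
  hook whose inversions all start at x.\<close>

lemma lec_Cons: "lec (x # w) = lec w + count_less x (fst (hook_factorization w))"
proof -
  obtain w0 hs where fact: "hook_factorization w = (w0, hs)" by fastforce
  then have "sorted w0" using hook_factorization[of w] by (simp add: is_hook_factorization_def)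
  then show ?thesis
    by (cases w0)
      (auto simp: lec_def fact hook_factorization_Cons[OF fact] inversion_number_Cons
        inversion_number_sorted filter_empty_conv)
qed

text \<open>The \<open>des\<close> claim needs the equality of subwords, not just of lengths, since
  its increment counts letters of the subword.\<close>

lemma phi_statistics:
  fixes w :: "'a::linorder list"
  assumes "distinct w"
  shows "aix_word (phi w) = fst (hook_factorization w) \<and> des (phi w) = lec w \<and>
    aid (phi w) = inversion_number w"
  using assms
proof (induction w)
  case Nil
  show ?case by (simp add: hook_factorization_Nil lec_def aid_def)
next
  case (Cons x w)
  then have w: "distinct w" "x \<notin> set w" by auto
  then have phi: "distinct (phi w)" "x \<notin> set (phi w)"
    by (simp_all add: distinct_phi set_phi)
  have count: "count_less x (phi w) = count_less x w"
    using mset_phi[OF w(1)] by (metis mset_filter size_mset)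
  obtain w0 hs where fact: "hook_factorization w = (w0, hs)" by fastforce
  show ?case
    using Cons.IH[OF w(1)]
    by (simp add: aix_word_f_map des_f_map aid_f_map phi count lec_Cons inversion_number_Cons
        fact hook_factorization_Cons[OF fact])
qed

theorem theorem2p4:
  fixes n :: nat and \<pi> :: "nat list"
  assumes "n \<ge> 1" and "\<pi> \<in> permutations_of_set {1..n}"
  shows "phi \<pi> \<in> permutations_of_set {1..n} \<and>
    (ini (phi \<pi>), aix (phi \<pi>), des (phi \<pi>), aid (phi \<pi>))
      = (ini \<pi>, pix \<pi>, lec \<pi>, inversion_number \<pi>)"
proof -
  have \<pi>: "distinct \<pi>" "set \<pi> = {1..n}"
    using assms(2) by (auto simp: permutations_of_set_def)
  then have "phi \<pi> \<in> permutations_of_set {1..n}"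
    by (simp add: permutations_of_set_def distinct_phi set_phi)
  moreover have "ini (phi \<pi>) = ini \<pi>"
  proof -
    obtain x w where "\<pi> = x # w" using \<pi> assms(1) by (cases \<pi>) auto
    with \<pi>(1) show ?thesis by (simp add: ini_def hd_f_map distinct_phi set_phi)
  qed
  ultimately show ?thesis
    using phi_statistics[OF \<pi>(1)] by (simp add: pix_def flip: length_aix_word)
qed

end
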